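(* Let $\|\cdot\|$ be a norm on the complex sequence space $l^\infty$ that is equivalent to the supremum norm $\|\cdot\|_\infty$, i.e., there are real numbers $C \ge c > 0$ such that $c\,\|x\|_\infty \le \|x\| \le C\,\|x\|_\infty$ for all $x \in l^\infty$. Suppose also that $$\liminf_{N\to\infty} \|P_N\| = 1 \quad\text{and}\quad \|x\| = \liminf_{N\to\infty} \|P_N x\| \ \text{ for all } x \in l^\infty,$$ where $P_N(x_1,x_2,\ldots) = (x_1,\ldots,x_N,0,0,\ldots)$ and $\|P_N\|$ is the operator norm of $P_N$ with respect to $\|\cdot\|$. Let $\alpha = (\alpha_1,\alpha_2,\alpha_3,\ldots) \in l^1$ be a sequence of strictly positive real numbers such that $\sum_{k=1}^\infty \alpha_k = 1$. Then there exist $w = (w_1,w_2,\ldots) \in l^\infty$ and $\phi = (\phi_1,\phi_2,\ldots) \in l^1$ such that $$\|w\| = 1, \quad \|\phi\|_* = 1, \quad\text{and}\quad w_k\,\phi_k = \alpha_k \ \text{ for all } k \in \mathbb{N}.$$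
   Context: $l^\infty$ is the space of bounded complex sequences $x=(x_1,x_2,\ldots)$ with $\|x\|_\infty = \sup_k |x_k|$, and $l^1$ is the space of absolutely summable complex sequences; $\mathbb{N} = \{1,2,\ldots\}$. For $N \in \mathbb{N}$, $P_N$ is the projection on $l^\infty$ given by $P_N(x_1,x_2,\ldots) = (x_1,\ldots,x_N,0,0,\ldots)$, and $\|P_N\| = \sup\{\|P_N x\| : x \in l^\infty, \|x\| \le 1\}$ is its operator norm with respect to the given norm $\|\cdot\|$ on $l^\infty$. The predual norm $\|\cdot\|_*$ on $l^1$ is defined, for $y = (y_1,y_2,\ldots) \in l^1$, by $$\|y\|_* = \sup\left\{ \left|\sum_{k=1}^\infty x_k y_k\right| : x \in l^\infty,\ \|x\| \le 1 \right\}.$$ *)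

theory Defs
  imports "HOL-Analysis.Analysis"
begin

text \<open>
  Sequences are functions on \<^typ>\<open>nat\<close> and hence indexed from \<open>0\<close>: the entry \<open>x k\<close> is the
  \<open>(k + 1)\<close>-st term of the sequence.  Norms on the bounded sequences are real-valued functions
  on all sequences, of which only the values on \<open>linf\<close> matter.
\<close>

definition linf :: "(nat \<Rightarrow> complex) set" where
  "linf = {x. bounded (range x)}"

definition l1 :: "(nat \<Rightarrow> complex) set" where
  "l1 = {y. summable (\<lambda>k. norm (y k))}"

definition sup_norm :: "(nat \<Rightarrow> complex) \<Rightarrow> real" where
  "sup_norm x = (SUP k. norm (x k))"

definition norm_on_linf :: "((nat \<Rightarrow> complex) \<Rightarrow> real) \<Rightarrow> bool" where
  "norm_on_linf \<nu> \<longleftrightarrow>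
     (\<forall>x\<in>linf. 0 \<le> \<nu> x) \<and>
     (\<forall>x\<in>linf. \<nu> x = 0 \<longleftrightarrow> x = (\<lambda>k. 0)) \<and>
     (\<forall>a. \<forall>x\<in>linf. \<nu> (\<lambda>k. a * x k) = norm a * \<nu> x) \<and>
     (\<forall>x\<in>linf. \<forall>y\<in>linf. \<nu> (\<lambda>k. x k + y k) \<le> \<nu> x + \<nu> y)"

definition proj :: "nat \<Rightarrow> (nat \<Rightarrow> complex) \<Rightarrow> nat \<Rightarrow> complex" where
  "proj N x = (\<lambda>k. if k < N then x k else 0)"

text \<open>
  The next two suprema are taken in \<^typ>\<open>real\<close>, where they are meaningful only for sets bounded
  above.  When \<open>\<nu>\<close> is equivalent to the supremum norm they are, for \<open>T = proj N\<close> and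
  \<open>y \<in> l1\<close> respectively; see \<open>bdd_above_op_norm_proj\<close> and \<open>bdd_above_predual_norm\<close> below.
\<close>

definition op_norm ::
    "((nat \<Rightarrow> complex) \<Rightarrow> real) \<Rightarrow> ((nat \<Rightarrow> complex) \<Rightarrow> nat \<Rightarrow> complex) \<Rightarrow> real" where
  "op_norm \<nu> T = Sup {\<nu> (T x) | x. x \<in> linf \<and> \<nu> x \<le> 1}"

definition predual_norm :: "((nat \<Rightarrow> complex) \<Rightarrow> real) \<Rightarrow> (nat \<Rightarrow> complex) \<Rightarrow> real" where
  "predual_norm \<nu> y = Sup {norm (\<Sum>k. x k * y k) | x. x \<in> linf \<and> \<nu> x \<le> 1}"

lemma norm_le_sup_norm:
  assumes "x \<in> linf"
  shows "norm (x k) \<le> sup_norm x"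
proof -
  have "bdd_above (range (\<lambda>k. norm (x k)))"
    using assms by (auto simp: linf_def bounded_iff bdd_above_def)
  then show ?thesis
    unfolding sup_norm_def by (rule cSUP_upper[OF UNIV_I])
qed

lemma sup_norm_le: "(\<And>k. norm (x k) \<le> B) \<Longrightarrow> sup_norm x \<le> B"
  unfolding sup_norm_def by (rule cSUP_least) auto

lemma proj_in_linf:
  assumes "x \<in> linf"
  shows "proj N x \<in> linf"
proof -
  have "norm (proj N x k) \<le> sup_norm x" for k
    using norm_le_sup_norm[OF assms, of k] order_trans[OF norm_ge_zero norm_le_sup_norm[OF assms]]
    by (auto simp: proj_def)
  then show ?thesis
    by (auto simp: linf_def bounded_iff)
qed

lemma sup_norm_proj_le:
  assumes "x \<in> linf"
  shows "sup_norm (proj N x) \<le> sup_norm x"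
proof (rule sup_norm_le)
  fix k
  show "norm (proj N x k) \<le> sup_norm x"
    using norm_le_sup_norm[OF assms, of k] order_trans[OF norm_ge_zero norm_le_sup_norm[OF assms]]
    by (auto simp: proj_def)
qed

lemma bdd_above_op_norm_proj:
  assumes c: "0 < c" "c \<le> C"
    and eq: "\<And>x. x \<in> linf \<Longrightarrow> c * sup_norm x \<le> \<nu> x \<and> \<nu> x \<le> C * sup_norm x"
  shows "bdd_above {\<nu> (proj N x) | x. x \<in> linf \<and> \<nu> x \<le> 1}"
proof (rule bdd_aboveI)
  fix r assume "r \<in> {\<nu> (proj N x) | x. x \<in> linf \<and> \<nu> x \<le> 1}"
  then obtain x where x: "x \<in> linf" "\<nu> x \<le> 1" and r: "r = \<nu> (proj N x)" by blast
  have "c * sup_norm x \<le> 1"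
    using eq[OF x(1)] x(2) by linarith
  then have s: "sup_norm x \<le> 1 / c"
    using c by (simp add: field_simps)
  have "r \<le> C * sup_norm (proj N x)"
    using eq[OF proj_in_linf[OF x(1)]] r by blast
  also have "\<dots> \<le> C * (1 / c)"
    using c sup_norm_proj_le[OF x(1), of N] s by (intro mult_left_mono) auto
  finally show "r \<le> C * (1 / c)" .
qed

lemma bdd_above_predual_norm:
  assumes c: "0 < c"
    and eq: "\<And>x. x \<in> linf \<Longrightarrow> c * sup_norm x \<le> \<nu> x"
    and y: "y \<in> l1"
  shows "bdd_above {norm (\<Sum>k. x k * y k) | x. x \<in> linf \<and> \<nu> x \<le> 1}"
proof (rule bdd_aboveI)
  fix r assume "r \<in> {norm (\<Sum>k. x k * y k) | x. x \<in> linf \<and> \<nu> x \<le> 1}"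
  then obtain x where x: "x \<in> linf" "\<nu> x \<le> 1" and r: "r = norm (\<Sum>k. x k * y k)" by blast
  have "c * sup_norm x \<le> 1"
    using eq[OF x(1)] x(2) by linarith
  then have s: "sup_norm x \<le> 1 / c"
    using c by (simp add: field_simps)
  have le: "norm (x k * y k) \<le> 1 / c * norm (y k)" for k
    unfolding norm_mult
    by (rule mult_right_mono[OF order_trans[OF norm_le_sup_norm[OF x(1)] s] norm_ge_zero])
  have sm: "summable (\<lambda>k. 1 / c * norm (y k))"
    using y unfolding l1_def by (intro summable_mult) auto
  show "r \<le> (\<Sum>k. 1 / c * norm (y k))"
    unfolding r by (rule norm_suminf_le[OF le sm])
qed

end

theory Submission
  imports Defs
begin

text \<open>
  The unit ball of \<open>\<nu>\<close> is compact for coordinatewise convergence.  Hence the weighted geometric mean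
  \<open>\<Prod>k<N. norm (x k) powr \<alpha> k\<close> has a maximiser \<open>w\<close> on it, and vanishing of the first variation in the
  direction \<open>x - w\<close> says that \<open>\<phi> k = \<alpha> k / w k\<close> (\<open>k < N\<close>) is a functional of norm at most \<open>1\<close>.
  This bounds \<open>\<phi>\<close>, so \<open>w\<close> stays away from \<open>0\<close> in each coordinate, and a
  coordinatewise limit along a subsequence \<open>N \<rightarrow> \<infinity>\<close> is the required factorization.
\<close>

section \<open>Weighted products of moduli on a compact convex set\<close>

lemma norm_one_plus_scaled_ge:
  fixes u :: complex
  shows "1 + t * (Re u - 1) \<le> norm (1 + of_real t * (u - 1))"
  using complex_Re_le_cmod[of "1 + of_real t * (u - 1)"] by simp

text \<open>The point \<open>z\<close> makes the maximum of the product positive, so no coordinate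
  of a maximiser \<open>w\<close> vanishes. If the inequality failed at \<open>x\<close>, a short
  move from \<open>w\<close> towards \<open>x\<close> would increase the product to first order.
  Moduli are not differentiable at 0 and need not be linear along the segment, so the product is
  compared with a smooth lower bound instead of being differentiated.\<close>

lemma weighted_prod_maximiser:
  fixes K :: "('i \<Rightarrow> complex) set" and \<alpha> :: "'i \<Rightarrow> real"
  assumes I: "finite I" and \<alpha>: "\<And>k. k \<in> I \<Longrightarrow> 0 < \<alpha> k"
    and K: "compact K"
    and convex: "\<And>x y t. \<lbrakk>x \<in> K; y \<in> K; 0 < t; t < 1\<rbrakk>
        \<Longrightarrow> (\<lambda>k. of_real (1 - t) * x k + of_real t * y k) \<in> K"
    and z: "z \<in> K" "\<And>k. k \<in> I \<Longrightarrow> z k \<noteq> 0"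
  obtains w where "w \<in> K" "\<And>k. k \<in> I \<Longrightarrow> w k \<noteq> 0"
    "\<And>x. x \<in> K \<Longrightarrow> (\<Sum>k\<in>I. \<alpha> k * Re (x k / w k)) \<le> (\<Sum>k\<in>I. \<alpha> k)"
proof -
  define f where "f x = (\<Prod>k\<in>I. norm (x k) powr \<alpha> k)" for x :: "'i \<Rightarrow> complex"
  have "continuous_on K f"
    unfolding f_def
    by (intro continuous_on_prod continuous_on_powr' continuous_on_norm continuous_on_const)
      (use \<alpha> in \<open>auto intro: continuous_on_subset[OF continuous_on_product_coordinates]\<close>)
  with K z(1) obtain w where w: "w \<in> K" and max: "\<And>x. x \<in> K \<Longrightarrow> f x \<le> f w"
    using continuous_attains_sup[of K f] by blast
  have "0 < f z"
    unfolding f_def using z(2) by (intro prod_pos) auto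
  then have fw: "0 < f w"
    using max[OF z(1)] by linarith
  have w0: "w k \<noteq> 0" if "k \<in> I" for k
  proof
    assume "w k = 0"
    with that I have "f w = 0"
      unfolding f_def by (auto intro!: bexI[of _ k])
    with fw show False by simp
  qed
  have "(\<Sum>k\<in>I. \<alpha> k * Re (x k / w k)) \<le> (\<Sum>k\<in>I. \<alpha> k)" if x: "x \<in> K" for x
  proof (rule ccontr)
    define a where "a k = Re (x k / w k) - 1" for k
    \<comment> \<open>\<open>h t\<close> is the logarithm of a lower bound for
      \<open>f y / f w\<close> at the point \<open>y\<close> of the segment with parameter
      \<open>t\<close>; its derivative at 0 is exactly the excess \<open>D\<close>.\<close>
    define h where "h t = (\<Sum>k\<in>I. \<alpha> k * ln (1 + t * a k))" for t
    assume "\<not> ?thesis"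
    then have D: "0 < (\<Sum>k\<in>I. \<alpha> k * a k)"
      by (simp add: a_def algebra_simps sum_subtractf)
    have "(h has_real_derivative (\<Sum>k\<in>I. \<alpha> k * a k)) (at 0)"
      unfolding h_def by (auto intro!: derivative_eq_intros sum.cong)
    from DERIV_pos_inc_right[OF this D]
    obtain d where d: "0 < d" "\<And>t. \<lbrakk>0 < t; t < d\<rbrakk> \<Longrightarrow> h 0 < h t"
      by auto
    \<comment> \<open>For small \<open>t\<close> all arguments of the logarithms are positive, so
      that \<open>exp (h t)\<close> is the product of the powers.\<close>
    have "\<forall>\<^sub>F t in at_right 0. \<forall>k\<in>I. 0 < 1 + t * a k"
    proof (intro eventually_ball_finite I ballI)
      fix k
      have "((\<lambda>t. 1 + t * a k) \<longlongrightarrow> 1 + 0 * a k) (at_right 0)"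
        by (intro tendsto_intros)
      then show "\<forall>\<^sub>F t in at_right 0. 0 < 1 + t * a k"
        by (rule order_tendstoD) simp
    qed
    moreover have "\<forall>\<^sub>F t in at_right 0. t \<in> {0<..<min d 1}"
      using d(1) by (intro eventually_at_right_real) simp
    ultimately have "\<forall>\<^sub>F t in at_right 0. (\<forall>k\<in>I. 0 < 1 + t * a k) \<and> t \<in> {0<..<min d 1}"
      by (rule eventually_conj)
    then obtain t where pos: "\<And>k. k \<in> I \<Longrightarrow> 0 < 1 + t * a k" and t: "0 < t" "t < d" "t < 1"
      using eventually_happens'[OF trivial_limit_at_right_real] by force
    define y where "y k = of_real (1 - t) * w k + of_real t * x k" for k
    have "y \<in> K"
      unfolding y_def using convex[OF w x t(1,3)] .
    \<comment> \<open>Factoring out \<open>w k\<close> leaves the modulus of a complex number near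
      1, which is at least its real part.\<close>
    have le: "norm (w k) * (1 + t * a k) \<le> norm (y k)" if "k \<in> I" for k
    proof -
      have "y k = w k * (1 + of_real t * (x k / w k - 1))"
        using w0[OF that] by (simp add: y_def field_simps)
      then show ?thesis
        using norm_one_plus_scaled_ge[of t "x k / w k"]
        by (simp add: norm_mult a_def mult_left_mono)
    qed
    have "0 < h t"
      using d(2)[OF t(1,2)] by (simp add: h_def)
    then have "f w < f w * exp (h t)"
      using fw by simp
    also have "\<dots> = (\<Prod>k\<in>I. (norm (w k) * (1 + t * a k)) powr \<alpha> k)"
      using pos by (simp add: f_def h_def exp_sum[OF I] powr_def[of "1 + _"] powr_mult less_imp_le
          less_imp_neq[THEN not_sym] flip: prod.distrib)
    also have "\<dots> \<le> f y"
      unfolding f_def using \<alpha> le pos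
      by (intro prod_mono conjI powr_mono2) (auto intro!: mult_nonneg_nonneg simp: less_imp_le)
    also have "\<dots> \<le> f w"
      using max[OF \<open>y \<in> K\<close>] .
    finally show False by simp
  qed
  then show ?thesis
    using that w w0 by blast
qed

section \<open>Bounded sequences and their pairing with summable ones\<close>

lemma linf_bounded_by: "(\<And>k. norm (x k) \<le> B) \<Longrightarrow> x \<in> linf"
  by (auto simp: linf_def bounded_iff)

lemma linf_cmult:
  assumes "x \<in> linf"
  shows "(\<lambda>k. a * x k) \<in> linf"
  using norm_le_sup_norm[OF assms]
  by (intro linf_bounded_by[where B = "norm a * sup_norm x"]) (simp add: norm_mult mult_left_mono)

lemma linf_add:
  assumes "x \<in> linf" "y \<in> linf"
  shows "(\<lambda>k. x k + y k) \<in> linf"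
  using norm_le_sup_norm[OF assms(1)] norm_le_sup_norm[OF assms(2)]
  by (intro linf_bounded_by[where B = "sup_norm x + sup_norm y"] norm_triangle_mono)

lemma summable_linf_mult_l1:
  assumes "x \<in> linf" "y \<in> l1"
  shows "summable (\<lambda>k. x k * y k)"
proof (rule summable_comparison_test')
  show "summable (\<lambda>k. sup_norm x * norm (y k))"
    using assms(2) unfolding l1_def by (intro summable_mult) auto
  show "norm (x k * y k) \<le> sup_norm x * norm (y k)" for k
    using norm_le_sup_norm[OF assms(1)] by (simp add: norm_mult mult_right_mono)
qed

section \<open>Norms equivalent to the supremum norm\<close>

locale equivalent_norm =
  fixes \<nu> :: "(nat \<Rightarrow> complex) \<Rightarrow> real" and c C :: real
  assumes norm_on: "norm_on_linf \<nu>"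
    and c_pos: "0 < c" and c_le_C: "c \<le> C"
    and equivalent: "\<And>x. x \<in> linf \<Longrightarrow> c * sup_norm x \<le> \<nu> x \<and> \<nu> x \<le> C * sup_norm x"
begin

definition "unit_ball = {x \<in> linf. \<nu> x \<le> 1}"

lemma C_pos: "0 < C"
  using c_pos c_le_C by linarith

lemma nu_cmult: "x \<in> linf \<Longrightarrow> \<nu> (\<lambda>k. a * x k) = norm a * \<nu> x"
  and nu_add: "\<lbrakk>x \<in> linf; y \<in> linf\<rbrakk> \<Longrightarrow> \<nu> (\<lambda>k. x k + y k) \<le> \<nu> x + \<nu> y"
  and nu_nonneg: "x \<in> linf \<Longrightarrow> 0 \<le> \<nu> x"
  and nu_eq_0: "x \<in> linf \<Longrightarrow> \<nu> x = 0 \<longleftrightarrow> x = (\<lambda>k. 0)"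
  using norm_on by (auto simp: norm_on_linf_def)

lemma nu_le:
  assumes "\<And>k. norm (x k) \<le> B"
  shows "\<nu> x \<le> C * B"
proof -
  have "\<nu> x \<le> C * sup_norm x"
    using equivalent linf_bounded_by[of x B, OF assms] by blast
  also have "\<dots> \<le> C * B"
    using C_pos sup_norm_le[OF assms] by simp
  finally show ?thesis .
qed

lemma unit_ball_coordinate_le:
  assumes "x \<in> unit_ball"
  shows "norm (x k) \<le> 1 / c"
proof -
  have x: "x \<in> linf" "\<nu> x \<le> 1"
    using assms by (auto simp: unit_ball_def)
  then have "c * norm (x k) \<le> c * sup_norm x"
    using norm_le_sup_norm c_pos by simp
  also have "\<dots> \<le> 1"
    using equivalent[OF x(1)] x(2) by linarith
  finally show ?thesis
    using c_pos by (simp add: field_simps)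
qed

lemma unit_ball_cmult:
  assumes "norm a = 1" "x \<in> unit_ball"
  shows "(\<lambda>k. a * x k) \<in> unit_ball"
  using assms by (simp add: unit_ball_def linf_cmult nu_cmult)

lemma unit_ball_convex:
  assumes x: "x \<in> unit_ball" and y: "y \<in> unit_ball" and t: "0 < t" "t < 1"
  shows "(\<lambda>k. of_real (1 - t) * x k + of_real t * y k) \<in> unit_ball"
proof -
  have l: "x \<in> linf" "y \<in> linf" "\<nu> x \<le> 1" "\<nu> y \<le> 1"
    using x y by (auto simp: unit_ball_def)
  have "\<nu> (\<lambda>k. of_real (1 - t) * x k + of_real t * y k)
      \<le> norm (of_real (1 - t) :: complex) * \<nu> x + norm (of_real t :: complex) * \<nu> y"
    using nu_add[OF linf_cmult[OF l(1), of "of_real (1 - t)"] linf_cmult[OF l(2), of "of_real t"]]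
    by (simp only: nu_cmult l)
  also have "\<dots> = (1 - t) * \<nu> x + t * \<nu> y"
    using t by (simp del: of_real_diff)
  also have "\<dots> \<le> 1"
    using convex_bound_le[of "\<nu> x" 1 "\<nu> y" "1 - t" t] l t by simp
  finally show ?thesis
    using l by (simp add: unit_ball_def linf_add linf_cmult del: of_real_diff)
qed

lemma op_norm_proj_ge:
  assumes "x \<in> unit_ball"
  shows "\<nu> (proj N x) \<le> op_norm \<nu> (proj N)"
  unfolding op_norm_def
  by (rule cSup_upper[OF _ bdd_above_op_norm_proj[OF c_pos c_le_C equivalent]])
    (use assms in \<open>auto simp: unit_ball_def\<close>)

text \<open>Convergence in the function space is coordinatewise, so \<open>\<nu>\<close> itself may
  fail to be continuous along \<open>X\<close>. After truncation only \<open>N\<close> coordinates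
  remain, and there equivalence with the supremum norm gives continuity.\<close>

lemma nu_proj_limit_le:
  assumes lim: "X \<longlonglongrightarrow> x" and X: "\<And>n. X n \<in> unit_ball"
  shows "\<nu> (proj N x) \<le> op_norm \<nu> (proj N)"
proof -
  define e where "e n = (\<Sum>k<N. norm (x k - X n k))" for n
  have coord: "(\<lambda>n. X n k) \<longlonglongrightarrow> x k" for k
    using continuous_on_tendsto_compose[OF continuous_on_product_coordinates lim] by simp
  have "(\<lambda>n. op_norm \<nu> (proj N) + C * e n) \<longlonglongrightarrow> op_norm \<nu> (proj N) + C * (\<Sum>k<N. norm (x k - x k))"
    unfolding e_def by (intro tendsto_intros coord)
  then have "(\<lambda>n. op_norm \<nu> (proj N) + C * e n) \<longlonglongrightarrow> op_norm \<nu> (proj N)"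
    by simp
  moreover have "\<nu> (proj N x) \<le> op_norm \<nu> (proj N) + C * e n" for n
  proof -
    \<comment> \<open>The error of the truncated sequences; each of its entries is at most the
      finite sum \<open>e n\<close>, which tends to 0.\<close>
    define d where "d = proj N (\<lambda>k. x k - X n k)"
    have d: "norm (d k) \<le> e n" for k
      unfolding d_def e_def proj_def by (auto intro!: member_le_sum sum_nonneg)
    have "proj N x = (\<lambda>k. proj N (X n) k + d k)"
      by (auto simp: proj_def d_def)
    then have "\<nu> (proj N x) \<le> \<nu> (proj N (X n)) + \<nu> d"
      using nu_add[OF proj_in_linf linf_bounded_by[of d, OF d], of "X n" N] X[of n]
      by (simp add: unit_ball_def)
    moreover have "\<nu> d \<le> C * e n"
      using d by (rule nu_le)
    ultimately show ?thesis
      using op_norm_proj_ge[OF X[of n], of N] by linarith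
  qed
  ultimately show ?thesis
    by (intro LIMSEQ_le_const) auto
qed

end

section \<open>Coordinatewise compactness of the unit ball\<close>

locale proj_norm = equivalent_norm +
  assumes op_norm_liminf: "liminf (\<lambda>N. ereal (op_norm \<nu> (proj N))) = 1"
    and nu_liminf: "\<And>x. x \<in> linf \<Longrightarrow> ereal (\<nu> x) = liminf (\<lambda>N. ereal (\<nu> (proj N x)))"
begin

text \<open>Both liminf hypotheses meet here: \<open>\<nu> x\<close> is the liminf of
  \<open>\<nu> (proj N x)\<close>, each of these is at most the operator norm of
  \<open>proj N\<close>, and those operator norms have liminf 1.\<close>

lemma closed_unit_ball: "closed unit_ball"
  unfolding closed_sequential_limits
proof (intro allI impI, elim conjE)
  fix X x assume X: "\<forall>n. X n \<in> unit_ball" and lim: "X \<longlonglongrightarrow> x"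
  have "(\<lambda>n. X n k) \<longlonglongrightarrow> x k" for k
    using continuous_on_tendsto_compose[OF continuous_on_product_coordinates lim] by simp
  then have "norm (x k) \<le> 1 / c" for k
    by (rule tendsto_upperbound[OF tendsto_norm]) (simp_all add: unit_ball_coordinate_le X)
  then have x: "x \<in> linf"
    by (rule linf_bounded_by)
  have "ereal (\<nu> x) \<le> liminf (\<lambda>N. ereal (op_norm \<nu> (proj N)))"
    unfolding nu_liminf[OF x] using nu_proj_limit_le[OF lim] X by (intro Liminf_mono) simp
  then show "x \<in> unit_ball"
    using x by (simp add: unit_ball_def op_norm_liminf)
qed

text \<open>By Tychonoff the product of the discs of radius \<open>1 / c\<close> is compact, and the
  ball is a closed subset of it.\<close>

lemma compact_unit_ball: "compact unit_ball"
proof -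
  have "compactin (product_topology (\<lambda>_. euclidean) UNIV) (PiE UNIV (\<lambda>_::nat. cball (0::complex) (1 / c)))"
    by (subst compactin_PiE) simp
  then have "compact (PiE UNIV (\<lambda>_::nat. cball (0::complex) (1 / c)))"
    by (simp add: euclidean_product_topology)
  moreover have "PiE UNIV (\<lambda>_. cball 0 (1 / c)) \<inter> unit_ball = unit_ball"
    using unit_ball_coordinate_le by auto
  ultimately show ?thesis
    using compact_Int_closed[OF _ closed_unit_ball] by metis
qed

section \<open>Finite factorizations and their limit\<close>

lemma finite_factorization:
  fixes \<alpha> :: "nat \<Rightarrow> real"
  assumes \<alpha>: "\<And>k. 0 < \<alpha> k" and sum: "(\<Sum>k<N. \<alpha> k) \<le> 1"
  obtains w where "w \<in> unit_ball" "\<And>k. k < N \<Longrightarrow> w k \<noteq> 0"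
    "\<And>x. x \<in> linf \<Longrightarrow> norm (\<Sum>k<N. x k * (of_real (\<alpha> k) / w k)) \<le> \<nu> x"
proof -
  \<comment> \<open>A constant sequence of height \<open>1 / C\<close> lies in the ball, since
    \<open>\<nu> z \<le> C * (1 / C)\<close>, and has no zero coordinate.\<close>
  define z :: "nat \<Rightarrow> complex" where "z k = of_real (1 / C)" for k
  have "norm (z k) \<le> 1 / C" for k
    using C_pos by (simp add: z_def norm_divide)
  from nu_le[of z, OF this] linf_bounded_by[of z, OF this]
  have z: "z \<in> unit_ball" "\<And>k. z k \<noteq> 0"
    using C_pos by (auto simp: unit_ball_def z_def)
  obtain w where w: "w \<in> unit_ball" "\<And>k. k \<in> {..<N} \<Longrightarrow> w k \<noteq> 0"
    and max: "\<And>x. x \<in> unit_ball \<Longrightarrow> (\<Sum>k<N. \<alpha> k * Re (x k / w k)) \<le> (\<Sum>k<N. \<alpha> k)"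
    by (rule weighted_prod_maximiser[where \<alpha> = \<alpha> and z = z, OF finite_lessThan[of N] \<alpha>
          compact_unit_ball unit_ball_convex z]) (assumption+, blast)
  define F where "F x = (\<Sum>k<N. x k * (of_real (\<alpha> k) / w k))" for x
  have F_cmult: "F (\<lambda>k. a * x k) = a * F x" for a x
    by (simp add: F_def sum_distrib_left mult.assoc)
  have Re_F: "Re (F x) \<le> 1" if "x \<in> unit_ball" for x
  proof -
    have "Re (x k * (of_real (\<alpha> k) / w k)) = \<alpha> k * Re (x k / w k)" for k
      using scaleR_complex.sel(1)[of "\<alpha> k" "x k / w k"] by (simp add: scaleR_conv_of_real mult.commute)
    then have "Re (F x) = (\<Sum>k<N. \<alpha> k * Re (x k / w k))"
      by (simp only: F_def Re_sum)
    also have "\<dots> \<le> 1"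
      using max[OF that] sum by linarith
    finally show ?thesis .
  qed
  have F_ball: "norm (F x) \<le> 1" if x: "x \<in> unit_ball" for x
  proof (cases "F x = 0")
    case False
    \<comment> \<open>Rotating \<open>x\<close> by this phase stays in the ball and makes
      \<open>F\<close> real and nonnegative, so the bound on real parts becomes one on
      moduli.\<close>
    define a where "a = cnj (sgn (F x))"
    have "norm a = 1"
      using False by (simp add: a_def norm_sgn)
    then have "Re (a * F x) \<le> 1"
      using Re_F[OF unit_ball_cmult[OF _ x]] by (simp add: F_cmult)
    moreover have "a * F x = of_real (norm (F x))"
      using False complex_norm_square[of "F x"]
      by (simp add: a_def sgn_eq power2_eq_square field_simps)
    ultimately show ?thesis
      by simp
  qed simp
  have "norm (F x) \<le> \<nu> x" if x: "x \<in> linf" for x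
  proof (cases "\<nu> x = 0")
    case True
    then show ?thesis
      using nu_eq_0[OF x] by (simp add: F_def)
  next
    case False
    then have pos: "0 < \<nu> x"
      using nu_nonneg[OF x] by simp
    define a :: complex where "a = of_real (1 / \<nu> x)"
    have a: "norm a = 1 / \<nu> x"
      using pos by (simp add: a_def norm_divide)
    then have "(\<lambda>k. a * x k) \<in> unit_ball"
      using pos x by (simp add: unit_ball_def linf_cmult nu_cmult)
    from F_ball[OF this] show ?thesis
      using pos by (simp add: F_cmult norm_mult a field_simps)
  qed
  then show ?thesis
    using that w unfolding F_def by blast
qed

text \<open>The first \<open>M\<close> terms of the functional at \<open>x\<close> are its value at
  \<open>proj M x\<close>, which is why the bound is \<open>\<nu> (proj M x)\<close>; truncation may
  increase \<open>\<nu>\<close>, so \<open>\<nu> x\<close> would not do. This bound survives the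
  limit over \<open>N\<close> for fixed \<open>M\<close>.\<close>

lemma factorization_partial_sums:
  fixes \<alpha> :: "nat \<Rightarrow> real"
  assumes \<alpha>: "\<And>k. 0 < \<alpha> k" and sum: "\<And>N. (\<Sum>k<N. \<alpha> k) \<le> 1"
  obtains w where "w \<in> unit_ball" "\<And>k. w k \<noteq> 0"
    "\<And>x M. x \<in> linf \<Longrightarrow> norm (\<Sum>k<M. x k * (of_real (\<alpha> k) / w k)) \<le> \<nu> (proj M x)"
proof -
  have "\<exists>W. \<forall>N. W N \<in> unit_ball \<and> (\<forall>k<N. W N k \<noteq> 0) \<and>
      (\<forall>x\<in>linf. norm (\<Sum>k<N. x k * (of_real (\<alpha> k) / W N k)) \<le> \<nu> x)"
    by (rule choice, rule allI, rule finite_factorization[OF \<alpha> sum]) blast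
  then obtain W where W: "\<And>N. W N \<in> unit_ball" "\<And>N k. k < N \<Longrightarrow> W N k \<noteq> 0"
    and bound: "\<And>N x. x \<in> linf \<Longrightarrow> norm (\<Sum>k<N. x k * (of_real (\<alpha> k) / W N k)) \<le> \<nu> x"
    by blast
  have proj_bound: "norm (\<Sum>k<M. x k * (of_real (\<alpha> k) / W N k)) \<le> \<nu> (proj M x)"
    if "x \<in> linf" "M \<le> N" for x M N
  proof -
    have "(\<Sum>k<N. proj M x k * (of_real (\<alpha> k) / W N k)) = (\<Sum>k<M. x k * (of_real (\<alpha> k) / W N k))"
      using that(2) by (intro sum.mono_neutral_cong_right) (auto simp: proj_def)
    then show ?thesis
      using bound[OF proj_in_linf[OF that(1)]] by metis
  qed
  \<comment> \<open>Testing the functional on the unit vector \<open>e\<close>, with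
    \<open>\<nu> e \<le> C\<close>, bounds its coefficient \<open>\<alpha> k / W N k\<close>
    uniformly in \<open>N\<close>; hence the limit \<open>w\<close> has no zero coordinate.\<close>
  have lower: "\<alpha> k / C \<le> norm (W N k)" if "k < N" for k N
  proof -
    define e :: "nat \<Rightarrow> complex" where "e j = (if j = k then 1 else 0)" for j
    have e: "norm (e j) \<le> 1" for j
      by (simp add: e_def)
    have "e j * (of_real (\<alpha> j) / W N j) = (if j = k then of_real (\<alpha> k) / W N k else 0)" for j
      by (simp add: e_def)
    then have "(\<Sum>j<N. e j * (of_real (\<alpha> j) / W N j)) = of_real (\<alpha> k) / W N k"
      using that by simp
    then have "norm (of_real (\<alpha> k) / W N k) \<le> C"
      using bound[OF linf_bounded_by[of e, OF e], of N] nu_le[of e, OF e] by simp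
    then show ?thesis
      using C_pos W(2)[OF that] \<alpha>[of k] by (simp add: norm_divide field_simps)
  qed
  obtain w r where w: "w \<in> unit_ball" and r: "strict_mono r" and lim: "(W \<circ> r) \<longlonglongrightarrow> w"
    using compact_unit_ball W(1) unfolding compact_def by blast
  have coord: "(\<lambda>n. W (r n) k) \<longlonglongrightarrow> w k" for k
    using continuous_on_tendsto_compose[OF continuous_on_product_coordinates lim] by simp
  have large: "\<forall>\<^sub>F n in sequentially. M \<le> r n" for M
    using filterlim_subseq[OF r] by (simp add: filterlim_at_top)
  have w0: "w k \<noteq> 0" for k
  proof -
    have "\<alpha> k / C \<le> norm (w k)"
    proof (rule tendsto_lowerbound[OF tendsto_norm[OF coord]])
      show "\<forall>\<^sub>F n in sequentially. \<alpha> k / C \<le> norm (W (r n) k)"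
        using large[of "Suc k"] by eventually_elim (simp add: lower)
    qed simp
    moreover have "0 < \<alpha> k / C"
      using \<alpha> C_pos by simp
    ultimately show ?thesis
      by auto
  qed
  have "norm (\<Sum>k<M. x k * (of_real (\<alpha> k) / w k)) \<le> \<nu> (proj M x)" if "x \<in> linf" for x M
  proof (rule tendsto_upperbound)
    show "(\<lambda>n. norm (\<Sum>k<M. x k * (of_real (\<alpha> k) / W (r n) k)))
        \<longlonglongrightarrow> norm (\<Sum>k<M. x k * (of_real (\<alpha> k) / w k))"
      using w0 by (intro tendsto_intros coord)
    show "\<forall>\<^sub>F n in sequentially. norm (\<Sum>k<M. x k * (of_real (\<alpha> k) / W (r n) k)) \<le> \<nu> (proj M x)"
      using large[of M] by eventually_elim (rule proj_bound[OF that])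
  qed simp
  then show ?thesis
    using that w w0 by blast
qed

lemma factorization:
  fixes \<alpha> :: "nat \<Rightarrow> real"
  assumes \<alpha>: "\<And>k. 0 < \<alpha> k" and sums: "\<alpha> sums 1"
  shows "\<exists>w\<in>linf. \<exists>\<phi>\<in>l1. \<nu> w = 1 \<and> predual_norm \<nu> \<phi> = 1 \<and>
           (\<forall>k. w k * \<phi> k = complex_of_real (\<alpha> k))"
proof -
  have "(\<Sum>k<N. \<alpha> k) \<le> 1" for N
    using sum_le_suminf[of \<alpha> "{..<N}"] sums \<alpha> by (simp add: sums_iff less_imp_le)
  from factorization_partial_sums[OF \<alpha> this]
  obtain w where w: "w \<in> unit_ball" "\<And>k. w k \<noteq> 0"
    and bound: "\<And>x M. x \<in> linf \<Longrightarrow> norm (\<Sum>k<M. x k * (of_real (\<alpha> k) / w k)) \<le> \<nu> (proj M x)"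
    by blast
  define \<phi> where "\<phi> k = of_real (\<alpha> k) / w k" for k
  have w\<phi>: "w k * \<phi> k = of_real (\<alpha> k)" for k
    using w(2) by (simp add: \<phi>_def)
  have \<phi>: "\<phi> \<in> l1"
  proof -
    \<comment> \<open>Pairing \<open>\<phi>\<close> with its conjugate phases yields the sums of
      \<open>norm (\<phi> k)\<close>. Truncations of \<open>s\<close> have supremum norm at most 1,
      so these sums are bounded by \<open>C\<close>.\<close>
    define s where "s k = cnj (sgn (\<phi> k))" for k
    have s: "norm (s k) \<le> 1" for k
      by (simp add: s_def norm_sgn)
    have "s k * \<phi> k = of_real (norm (\<phi> k))" for k
      using complex_norm_square[of "\<phi> k"]
      by (cases "\<phi> k = 0") (simp_all add: s_def sgn_eq power2_eq_square field_simps)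
    then have "(\<Sum>k<M. s k * \<phi> k) = of_real (\<Sum>k<M. norm (\<phi> k))" for M
      by simp
    then have "(\<Sum>k<M. norm (\<phi> k)) = norm (\<Sum>k<M. s k * \<phi> k)" for M
      by (simp only: norm_of_real) (simp add: sum_nonneg)
    moreover have "norm (\<Sum>k<M. s k * \<phi> k) \<le> \<nu> (proj M s)" for M
      using bound[OF linf_bounded_by[of s, OF s], of M] by (simp add: \<phi>_def)
    moreover have "\<nu> (proj M s) \<le> C * 1" for M
      using s by (intro nu_le) (simp add: proj_def)
    ultimately have "(\<Sum>k<M. norm (\<phi> k)) \<le> C" for M
      by (metis mult.right_neutral order.trans)
    then show ?thesis
      unfolding l1_def mem_Collect_eq by (intro summableI_nonneg_bounded[where x = C]) auto
  qed
  have dual_bound: "norm (\<Sum>k. x k * \<phi> k) \<le> \<nu> x" if x: "x \<in> linf" for x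
  proof -
    \<comment> \<open>The partial sums converge, but \<open>\<nu> (proj M x)\<close> is only known
      to have liminf \<open>\<nu> x\<close>; the limit is therefore rewritten as a liminf and
      compared termwise.\<close>
    have "(\<lambda>M. ereal (norm (\<Sum>k<M. x k * \<phi> k))) \<longlonglongrightarrow> ereal (norm (\<Sum>k. x k * \<phi> k))"
      using summable_LIMSEQ[OF summable_linf_mult_l1[OF x \<phi>]] by (intro tendsto_intros)
    from lim_imp_Liminf[OF _ this]
    have "ereal (norm (\<Sum>k. x k * \<phi> k)) = liminf (\<lambda>M. ereal (norm (\<Sum>k<M. x k * \<phi> k)))"
      by simp
    also have "\<dots> \<le> ereal (\<nu> x)"
      unfolding nu_liminf[OF x] using bound[OF x] by (intro Liminf_mono) (simp add: \<phi>_def)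
    finally show ?thesis
      by simp
  qed
  have pairing: "(\<Sum>k. w k * \<phi> k) = 1"
    using sums_of_real[OF sums, where 'a = complex] by (simp add: w\<phi> sums_iff)
  have wl: "w \<in> linf" "\<nu> w \<le> 1"
    using w(1) by (auto simp: unit_ball_def)
  \<comment> \<open>The pairing of \<open>w\<close> with \<open>\<phi>\<close> is the sum of the
    \<open>\<alpha> k\<close>, so 1 is at most \<open>\<nu> w\<close>, while \<open>w\<close> lies
    in the ball. The same pairing shows that the supremum in the predual norm is attained at
    \<open>w\<close>.\<close>
  have "\<nu> w = 1"
    using dual_bound[OF wl(1)] wl(2) by (simp add: pairing)
  moreover have "predual_norm \<nu> \<phi> = 1"
    unfolding predual_norm_def
  proof (rule cSup_eq_maximum)
    show "1 \<in> {norm (\<Sum>k. x k * \<phi> k) |x. x \<in> linf \<and> \<nu> x \<le> 1}"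
      using wl pairing by (auto intro!: exI[of _ w])
  qed (use dual_bound in \<open>auto intro: order_trans\<close>)
  ultimately show ?thesis
    using wl(1) \<phi> w\<phi> by blast
qed

end

theorem theorem2p1:
  fixes \<nu> :: "(nat \<Rightarrow> complex) \<Rightarrow> real"
    and c C :: real
    and \<alpha> :: "nat \<Rightarrow> real"
  assumes "norm_on_linf \<nu>"
    and "0 < c" and "c \<le> C"
    and "\<forall>x\<in>linf. c * sup_norm x \<le> \<nu> x \<and> \<nu> x \<le> C * sup_norm x"
    and "liminf (\<lambda>N. ereal (op_norm \<nu> (proj N))) = 1"
    and "\<forall>x\<in>linf. ereal (\<nu> x) = liminf (\<lambda>N. ereal (\<nu> (proj N x)))"
    and "(\<lambda>k. complex_of_real (\<alpha> k)) \<in> l1"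
    and "\<forall>k. 0 < \<alpha> k"
    and "(\<Sum>k. \<alpha> k) = 1"
  shows "\<exists>w\<in>linf. \<exists>\<phi>\<in>l1. \<nu> w = 1 \<and> predual_norm \<nu> \<phi> = 1 \<and>
           (\<forall>k. w k * \<phi> k = complex_of_real (\<alpha> k))"
proof -
  interpret proj_norm \<nu> c C
    using assms(1-6) by unfold_locales auto
  have "summable \<alpha>"
    using assms(7,8) by (simp add: l1_def less_imp_le)
  then have "\<alpha> sums 1"
    using assms(9) by (simp add: sums_iff)
  then show ?thesis
    using assms(8) by (intro factorization) auto
qed

end
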